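(* Any data structure that, for a graph on $n$ vertices with positive edge capacities and a designated source vertex $s$ and sink vertex $t$, reports the capacity of the $(s,t)$-mincut after the failure (removal) of any single edge must require $\Omega(n^2\log n)$ bits of space in the worst case, irrespective of its query time. This holds both for undirected and for directed graphs.
   Context: An $(s,t)$-cut is a set $C$ of vertices with $s\in C$, $t\notin C$; its capacity is the total capacity of edges leaving $C$ (for undirected graphs: edges with exactly one endpoint in $C$); the $(s,t)$-mincut capacity is the minimum capacity of an $(s,t)$-cut. *)

theory Defs
  imports Complex_Main
begin

text \<open>
  A capacitated graph is a partial map from edges to capacities: its domain is the edge set, so
  every labelled graph has exactly one representation and the failure of the edge \<open>e\<close> is
  \<open>G(e := None)\<close>.  A directed edge is a pair of distinct vertices, an undirected edge a set of two
  vertices.  The parameter \<open>W\<close> is the set of admissible capacities.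
\<close>

definition directed_graphs :: "'v set \<Rightarrow> real set \<Rightarrow> ('v \<times> 'v \<rightharpoonup> real) set" where
  "directed_graphs V W = {G. dom G \<subseteq> {(u, v). u \<in> V \<and> v \<in> V \<and> u \<noteq> v} \<and> ran G \<subseteq> W}"

definition undirected_graphs :: "'v set \<Rightarrow> real set \<Rightarrow> ('v set \<rightharpoonup> real) set" where
  "undirected_graphs V W = {G. dom G \<subseteq> {e. e \<subseteq> V \<and> card e = 2} \<and> ran G \<subseteq> W}"

definition directed_leaves :: "'v set \<Rightarrow> 'v \<times> 'v \<Rightarrow> bool" where
  "directed_leaves C e \<longleftrightarrow> fst e \<in> C \<and> snd e \<notin> C"

definition undirected_leaves :: "'v set \<Rightarrow> 'v set \<Rightarrow> bool" where
  "undirected_leaves C e \<longleftrightarrow> card (e \<inter> C) = 1"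

definition st_cuts :: "'v set \<Rightarrow> 'v \<Rightarrow> 'v \<Rightarrow> 'v set set" where
  "st_cuts V s t = {C. C \<subseteq> V \<and> s \<in> C \<and> t \<notin> C}"

text \<open>Below, \<open>leaves\<close> is either \<open>directed_leaves\<close> or \<open>undirected_leaves\<close>.\<close>

definition cut_capacity :: "('v set \<Rightarrow> 'e \<Rightarrow> bool) \<Rightarrow> ('e \<rightharpoonup> real) \<Rightarrow> 'v set \<Rightarrow> real" where
  "cut_capacity leaves G C = (\<Sum>e | e \<in> dom G \<and> leaves C e. the (G e))"

definition mincut_capacity ::
    "('v set \<Rightarrow> 'e \<Rightarrow> bool) \<Rightarrow> 'v set \<Rightarrow> 'v \<Rightarrow> 'v \<Rightarrow> ('e \<rightharpoonup> real) \<Rightarrow> real" where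
  "mincut_capacity leaves V s t G = Min (cut_capacity leaves G ` st_cuts V s t)"

text \<open>
  A data structure consists of an arbitrary preprocessing function, which stores each input graph
  as a bit string, and an arbitrary query function, which sees only this bit string and the failed
  edge.  Nothing is assumed about running time or computability.
\<close>

definition mincut_failure_oracle ::
    "('v set \<Rightarrow> 'e \<Rightarrow> bool) \<Rightarrow> ('e \<rightharpoonup> real) set \<Rightarrow> 'v set \<Rightarrow> 'v \<Rightarrow> 'v \<Rightarrow>
     (('e \<rightharpoonup> real) \<Rightarrow> bool list) \<Rightarrow> (bool list \<Rightarrow> 'e \<Rightarrow> real) \<Rightarrow> bool" where
  "mincut_failure_oracle leaves \<G> V s t encode query \<longleftrightarrow>
     (\<forall>G \<in> \<G>. \<forall>e \<in> dom G.
        query (encode G) e = mincut_capacity leaves V s t (G(e := None)))"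

text \<open>
  A set of positive capacities admissible for graphs on \<open>n\<close> vertices.  It may be the set of all
  positive reals or of all positive integers, but a lower bound for these alone would be
  degenerate: no encoding by finite bit strings handles all real capacities, and unbounded
  integers need unbounded space already for a fixed edge set.  The only
  requirement is therefore that the integers from 1 to \<open>n\<^sup>2\<close>, which fit into \<open>O(log n)\<close> bits, are
  allowed.
\<close>

definition admissible_capacities :: "nat \<Rightarrow> real set \<Rightarrow> bool" where
  "admissible_capacities n W \<longleftrightarrow> W \<subseteq> {0<..} \<and> real ` {1..n^2} \<subseteq> W"

end

theory Submission
  imports Defs "HOL-Library.FuncSet"
begin

text \<open>
  Split the vertices into \<open>A \<ni> s\<close> and \<open>B \<ni> t\<close> of about equal size, give all edges between \<open>A\<close>
  and \<open>B\<close> arbitrary capacities in \<open>{1..n}\<close>, and join \<open>s\<close> to the rest of \<open>A\<close> and the rest of \<open>B\<close>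
  to \<open>t\<close> by edges of capacity \<open>n\<^sup>2\<close>.  The heavy edges force \<open>A\<close> to be a minimum cut, also after
  the failure of an edge between \<open>A\<close> and \<open>B\<close>, so the answers for these failures are \<open>S - w e\<close>
  with \<open>S\<close> the sum of all \<open>w e\<close>.  As there are at least two such edges, the answers determine
  \<open>w\<close>, and hence the \<open>n ^ (card A * card B)\<close> graphs obtained in this way need distinct bit strings.
\<close>

section \<open>Counting codes and taking logarithms\<close>

lemma long_code_exists:
  fixes encode :: "'a \<Rightarrow> bool list"
  assumes "finite F" "F \<noteq> {}" "inj_on encode F"
  shows "\<exists>x\<in>F. card F < 2 ^ Suc (length (encode x))"
proof -
  \<comment> \<open>Only \<open>2 ^ Suc L - 1\<close> bit strings have length at most
    \<open>L\<close>, and an injective code uses \<open>card F\<close> of them.\<close>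
  define L where "L = Max ((\<lambda>x. length (encode x)) ` F)"
  have "L \<in> (\<lambda>x. length (encode x)) ` F"
    unfolding L_def using assms by (intro Max_in) auto
  then obtain x where x: "x \<in> F" "L = length (encode x)" by auto
  let ?S = "{xs. set xs \<subseteq> (UNIV :: bool set) \<and> length xs \<le> L}"
  have "encode ` F \<subseteq> ?S"
    unfolding L_def using assms by auto
  then have "card (encode ` F) \<le> card ?S"
    by (intro card_mono finite_lists_length_le) auto
  then have "card F \<le> card ?S" by (simp only: card_image[OF assms(3)])
  also have "\<dots> = (\<Sum>i<Suc L. 2 ^ i)"
    using card_lists_length_le[of "UNIV :: bool set" L] by (simp add: lessThan_Suc_atMost)
  also have "\<dots> < 2 ^ Suc L"
    using sum_power2[of "Suc L"] by (simp add: atLeast0LessThan)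
  finally show ?thesis using x by blast
qed

text \<open>Logarithms turn the count into \<open>m * log 2 n < l + 1\<close>. For
  \<open>n \<ge> 4\<close>, \<open>m\<close> exceeds \<open>n\<^sup>2 / 8\<close> by at least one,
  and the spare \<open>log 2 n\<close> absorbs the additive 1.\<close>

lemma log_bound:
  fixes n m l :: nat
  assumes n: "n \<ge> 4" and m: "4 * m + 1 \<ge> n\<^sup>2" and l: "n ^ m < 2 ^ Suc l"
  shows "1/8 * (real n)\<^sup>2 * log 2 (real n) \<le> real l"
proof -
  have lg: "log 2 (real n) \<ge> 2"
    using n by (simp add: le_log_iff)
  have "real n ^ m < 2 ^ Suc l"
    using of_nat_less_iff[of "n ^ m" "2 ^ Suc l", where 'a = real] l by simp
  then have "log 2 (real n ^ m) < log 2 (2 ^ Suc l)"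
    using n by (intro log_less) auto
  then have 1: "real m * log 2 (real n) < real l + 1"
    using n by (simp add: log_nat_power log_mult)
  have m': "4 * real m + 1 \<ge> (real n)\<^sup>2"
    using of_nat_mono[OF m, where 'a = real] by simp
  have "(real n)\<^sup>2 \<ge> 4\<^sup>2"
    using n by (intro power_mono) auto
  then have "real m \<ge> 1/8 * (real n)\<^sup>2 + 1"
    using m' by simp
  then have "(1/8 * (real n)\<^sup>2 + 1) * log 2 (real n) \<le> real m * log 2 (real n)"
    using lg by (intro mult_right_mono) auto
  then show ?thesis
    using 1 lg by (simp add: algebra_simps)
qed

text \<open>Common ground of directed and undirected edges. The case \<open>u \<notin> C\<close>,
  \<open>v \<in> C\<close>, on which the two disagree, is left open. The condition
  \<open>u \<noteq> v\<close> excludes the degenerate \<open>{u, u}\<close>, which meets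
  \<open>C\<close> in one vertex if \<open>u \<in> C\<close>.\<close>

locale edge_model =
  fixes mk :: "'v \<Rightarrow> 'v \<Rightarrow> 'e" and leaves :: "'v set \<Rightarrow> 'e \<Rightarrow> bool"
  assumes mk_eqD: "mk u v = mk u' v' \<Longrightarrow> u = u' \<and> v = v' \<or> u = v' \<and> v = u'"
    and leaves_mk: "u \<in> C \<Longrightarrow> v \<notin> C \<Longrightarrow> leaves C (mk u v)"
    and not_leaves_mk: "u \<noteq> v \<Longrightarrow> u \<in> C \<longleftrightarrow> v \<in> C \<Longrightarrow> \<not> leaves C (mk u v)"
begin

definition graphs :: "'v set \<Rightarrow> real set \<Rightarrow> ('e \<rightharpoonup> real) set" where
  "graphs V W = {G. dom G \<subseteq> {mk u v | u v. u \<in> V \<and> v \<in> V \<and> u \<noteq> v} \<and> ran G \<subseteq> W}"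

end

section \<open>The family of weighted networks\<close>

locale split_network = edge_model mk leaves
  for mk :: "'v \<Rightarrow> 'v \<Rightarrow> 'e" and leaves +
  fixes A B :: "'v set" and s t :: 'v
  assumes finA: "finite A" and finB: "finite B" and disj: "A \<inter> B = {}"
    and sA: "s \<in> A" and tB: "t \<in> B"
begin

definition arcs :: "('v \<times> 'v) set" where
  "arcs = A \<times> B \<union> ({s} \<times> (A - {s}) \<union> (B - {t}) \<times> {t})"

definition arc_capacity :: "real \<Rightarrow> ('v \<times> 'v \<Rightarrow> real) \<Rightarrow> 'v \<times> 'v \<Rightarrow> real" where
  "arc_capacity M w p = (if p \<in> A \<times> B then w p else M)"

definition network :: "real \<Rightarrow> ('v \<times> 'v \<Rightarrow> real) \<Rightarrow> 'e \<rightharpoonup> real" where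
  "network M w e =
     (if e \<in> case_prod mk ` arcs
      then Some (arc_capacity M w (inv_into arcs (case_prod mk) e)) else None)"

definition arc_cut :: "real \<Rightarrow> ('v \<times> 'v \<Rightarrow> real) \<Rightarrow> 'v set \<Rightarrow> real" where
  "arc_cut M w C = (\<Sum>p\<in>arcs. if leaves C (case_prod mk p) then arc_capacity M w p else 0)"

lemma finite_arcs: "finite arcs"
  using finA finB by (simp add: arcs_def)

text \<open>No arc occurs together with its reverse, so even an unordered edge determines its arc.
  Hence \<open>inv_into\<close> in \<open>network\<close> recovers the intended arc.\<close>

lemma inj_mk: "inj_on (case_prod mk) arcs"
proof (rule inj_onI)
  fix p q assume pq: "p \<in> arcs" "q \<in> arcs" "case_prod mk p = case_prod mk q"
  obtain u v u' v' where e: "p = (u, v)" "q = (u', v')" by fastforce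
  have "u = u' \<and> v = v' \<or> u = v' \<and> v = u'"
    using pq e mk_eqD by auto
  then show "p = q"
    using pq(1,2) disj sA tB unfolding e arcs_def by auto
qed

lemma network_mk: "p \<in> arcs \<Longrightarrow> network M w (case_prod mk p) = Some (arc_capacity M w p)"
  using inj_mk by (simp add: network_def inv_into_f_f)

lemma dom_network: "dom (network M w) = case_prod mk ` arcs"
  by (auto simp: network_def split: if_splits)

lemma network_in_graphs:
  assumes "M \<in> W" "w ` (A \<times> B) \<subseteq> W" "A \<union> B \<subseteq> V"
  shows "network M w \<in> graphs V W"
proof -
  have "arcs \<subseteq> {(u, v). u \<in> V \<and> v \<in> V \<and> u \<noteq> v}"
    using assms(3) disj sA tB by (auto simp: arcs_def)
  then have "dom (network M w) \<subseteq> {mk u v | u v. u \<in> V \<and> v \<in> V \<and> u \<noteq> v}"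
    unfolding dom_network by fastforce
  moreover have "ran (network M w) \<subseteq> W"
    using assms(1,2) by (auto simp: image_subset_iff ran_def network_def arc_capacity_def split: if_splits)
  ultimately show ?thesis by (simp add: graphs_def)
qed

text \<open>For every cut, losing an edge amounts to giving it weight 0. Failures thus stay within
  weighted networks, and the cut bounds must admit zero weights.\<close>

lemma cut_capacity_failure:
  assumes p0: "p0 \<in> A \<times> B"
  shows "cut_capacity leaves ((network M w)(case_prod mk p0 := None)) C = arc_cut M (w(p0 := 0)) C"
proof -
  let ?f = "case_prod mk" let ?G = "(network M w)(?f p0 := None)"
  let ?P = "{p \<in> arcs - {p0}. leaves C (?f p)}"
  have p0a: "p0 \<in> arcs" using p0 by (auto simp: arcs_def)
  have ne: "?f p \<noteq> ?f p0" if "p \<in> arcs - {p0}" for p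
    using inj_onD[OF inj_mk _ _ p0a] that by blast
  have dom: "{e. e \<in> dom ?G \<and> leaves C e} = ?f ` ?P"
    using ne unfolding dom_fun_upd dom_network by auto
  have "cut_capacity leaves ?G C = (\<Sum>p\<in>?P. the (?G (?f p)))"
    unfolding cut_capacity_def dom
    by (subst sum.reindex) (auto intro: inj_on_subset[OF inj_mk])
  also have "\<dots> = (\<Sum>p\<in>?P. arc_capacity M (w(p0 := 0)) p)"
  proof (rule sum.cong[OF refl])
    fix p assume "p \<in> ?P"
    then show "the (?G (?f p)) = arc_capacity M (w(p0 := 0)) p"
      using ne network_mk[of p M w] by (auto simp: arc_capacity_def)
  qed
  also have "\<dots> = (\<Sum>p\<in>arcs. if leaves C (?f p) then arc_capacity M (w(p0 := 0)) p else 0)"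
    using finite_arcs p0 by (intro sum.mono_neutral_cong_left) (auto simp: arc_capacity_def)
  finally show ?thesis by (simp add: arc_cut_def)
qed

section \<open>Cut values and minimum cuts\<close>

lemma arc_cut_split:
  "arc_cut M w C =
     (\<Sum>a\<in>A. \<Sum>b\<in>B. if leaves C (mk a b) then w (a, b) else 0) +
     ((\<Sum>a\<in>A - {s}. if leaves C (mk s a) then M else 0) +
      (\<Sum>b\<in>B - {t}. if leaves C (mk b t) then M else 0))"
proof -
  let ?g = "\<lambda>p. if leaves C (case_prod mk p) then arc_capacity M w p else 0"
  have d: "A \<times> B \<inter> ({s} \<times> (A - {s}) \<union> (B - {t}) \<times> {t}) = {}"
    "{s} \<times> (A - {s}) \<inter> (B - {t}) \<times> {t} = {}"
    using disj sA tB by auto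
  have 0: "sum ?g (A \<times> B) = (\<Sum>a\<in>A. \<Sum>b\<in>B. if leaves C (mk a b) then w (a, b) else 0)"
    unfolding sum.cartesian_product by (intro sum.cong) (auto simp: arc_capacity_def)
  have "sum ?g ({s} \<times> (A - {s})) = (\<Sum>u\<in>{s}. \<Sum>a\<in>A - {s}. if leaves C (mk u a) then M else 0)"
    unfolding sum.cartesian_product using disj
    by (intro sum.cong) (auto simp: arc_capacity_def)
  moreover have "sum ?g ((B - {t}) \<times> {t}) =
      (\<Sum>b\<in>B - {t}. \<Sum>v\<in>{t}. if leaves C (mk b v) then M else 0)"
    unfolding sum.cartesian_product using disj
    by (intro sum.cong) (auto simp: arc_capacity_def)
  moreover have "arc_cut M w C =
      sum ?g (A \<times> B) + (sum ?g ({s} \<times> (A - {s})) + sum ?g ((B - {t}) \<times> {t}))"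
    unfolding arc_cut_def arcs_def using d finA finB
    by (simp add: sum.union_disjoint)
  ultimately show ?thesis using 0 by simp
qed

text \<open>Every edge between \<open>A\<close> and \<open>B\<close> leaves \<open>A\<close>, while
  each heavy edge has both ends on the same side.\<close>

lemma arc_cut_side: "arc_cut M w A = (\<Sum>p\<in>A \<times> B. w p)"
proof -
  have "leaves A (mk a b)" if "a \<in> A" "b \<in> B" for a b
    using that disj leaves_mk by blast
  then have 1: "(\<Sum>a\<in>A. \<Sum>b\<in>B. if leaves A (mk a b) then w (a, b) else 0) = (\<Sum>p\<in>A \<times> B. w p)"
    unfolding sum.cartesian_product by (intro sum.cong) auto
  have "\<not> leaves A (mk s a)" if "a \<in> A - {s}" for a
    using that sA not_leaves_mk[of s a A] by auto
  then have 2: "(\<Sum>a\<in>A - {s}. if leaves A (mk s a) then M else 0) = 0"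
    by (intro sum.neutral) auto
  have 3: "(\<Sum>b\<in>B - {t}. if leaves A (mk b t) then M else 0) = 0"
    using tB disj not_leaves_mk[of _ t A] by (intro sum.neutral) auto
  show ?thesis unfolding arc_cut_split 1 2 3 by simp
qed

text \<open>
  If an edge \<open>(a, b)\<close> does not leave \<open>C\<close>, then \<open>a \<notin> C\<close> or \<open>b \<in> C\<close>; its weight is charged to the
  heavy edge \<open>(s, a)\<close> or \<open>(b, t)\<close>, which then leaves \<open>C\<close>.
\<close>

lemma arc_cut_lower:
  assumes w0: "\<And>p. p \<in> A \<times> B \<Longrightarrow> 0 \<le> w p"
    and row: "\<And>a. a \<in> A \<Longrightarrow> (\<Sum>b\<in>B. w (a, b)) \<le> M"
    and col: "\<And>b. b \<in> B \<Longrightarrow> (\<Sum>a\<in>A. w (a, b)) \<le> M"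
    and C: "s \<in> C" "t \<notin> C"
  shows "(\<Sum>p\<in>A \<times> B. w p) \<le> arc_cut M w C"
proof -
  have M0: "0 \<le> M"
    using row[OF sA] sum_nonneg[of B "\<lambda>b. w (s, b)"] w0 sA by force
  let ?X = "\<Sum>a\<in>A. \<Sum>b\<in>B. if leaves C (mk a b) then w (a, b) else 0"
  let ?Y = "\<Sum>a\<in>A. \<Sum>b\<in>B. if a \<notin> C then w (a, b) else 0"
  let ?Z = "\<Sum>a\<in>A. \<Sum>b\<in>B. if b \<in> C then w (a, b) else 0"
  have "(\<Sum>p\<in>A \<times> B. w p) = (\<Sum>a\<in>A. \<Sum>b\<in>B. w (a, b))"
    unfolding sum.cartesian_product by (rule sum.cong) auto
  also have "\<dots> \<le> (\<Sum>a\<in>A. \<Sum>b\<in>B. (if leaves C (mk a b) then w (a, b) else 0) +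
      ((if a \<notin> C then w (a, b) else 0) + (if b \<in> C then w (a, b) else 0)))"
    using w0 leaves_mk by (intro sum_mono) auto
  also have "\<dots> = ?X + (?Y + ?Z)" by (simp only: sum.distrib)
  finally have le: "(\<Sum>p\<in>A \<times> B. w p) \<le> ?X + (?Y + ?Z)" .
  have "?Y \<le> (\<Sum>a\<in>A. if a \<notin> C then M else 0)"
    using row by (intro sum_mono) auto
  \<comment> \<open>The row of \<open>s\<close> is never charged, because \<open>s \<in> C\<close>;
    every other row has its own heavy edge.\<close>
  also have "\<dots> = (\<Sum>a\<in>A - {s}. if a \<notin> C then M else 0)"
    using finA C by (intro sum.mono_neutral_right) auto
  also have "\<dots> \<le> (\<Sum>a\<in>A - {s}. if leaves C (mk s a) then M else 0)"
    using leaves_mk C M0 by (intro sum_mono) auto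
  finally have Y: "?Y \<le> \<dots>" .
  have "?Z = (\<Sum>b\<in>B. \<Sum>a\<in>A. if b \<in> C then w (a, b) else 0)" by (rule sum.swap)
  also have "\<dots> \<le> (\<Sum>b\<in>B. if b \<in> C then M else 0)"
    using col by (intro sum_mono) auto
  also have "\<dots> = (\<Sum>b\<in>B - {t}. if b \<in> C then M else 0)"
    using finB C by (intro sum.mono_neutral_right) auto
  also have "\<dots> \<le> (\<Sum>b\<in>B - {t}. if leaves C (mk b t) then M else 0)"
    using leaves_mk C M0 by (intro sum_mono) auto
  finally have Z: "?Z \<le> \<dots>" .
  show ?thesis unfolding arc_cut_split using le Y Z by linarith
qed

text \<open>With weights in \<open>[0, K]\<close>, \<open>M\<close> dominates every row and column
  sum, and zeroing one weight preserves this. So \<open>arc_cut_lower\<close> applies after the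
  failure, and the cut \<open>A\<close> attains the bound.\<close>

lemma mincut_capacity_failure:
  assumes w: "\<And>p. p \<in> A \<times> B \<Longrightarrow> 0 \<le> w p \<and> w p \<le> K"
    and M: "real (card A) * K \<le> M" "real (card B) * K \<le> M"
    and p0: "p0 \<in> A \<times> B"
  shows "mincut_capacity leaves (A \<union> B) s t ((network M w)(case_prod mk p0 := None)) =
    (\<Sum>p\<in>A \<times> B. w p) - w p0"
proof -
  define w' where "w' = w(p0 := 0)"
  have K: "0 \<le> K" using w[OF p0] by linarith
  have w': "0 \<le> w' p \<and> w' p \<le> K" if "p \<in> A \<times> B" for p
    using w[OF that] K by (auto simp: w'_def)
  have row: "(\<Sum>b\<in>B. w' (a, b)) \<le> M" if "a \<in> A" for a
    using sum_bounded_above[of B "\<lambda>b. w' (a, b)" K] w' that M(2) by fastforce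
  have col: "(\<Sum>a\<in>A. w' (a, b)) \<le> M" if "b \<in> B" for b
    using sum_bounded_above[of A "\<lambda>a. w' (a, b)" K] w' that M(1) by fastforce
  have low: "(\<Sum>p\<in>A \<times> B. w' p) \<le> arc_cut M w' C" if "s \<in> C" "t \<notin> C" for C
    using arc_cut_lower[of w' M C] w' row col that by blast
  have AC: "A \<in> st_cuts (A \<union> B) s t"
    using sA tB disj by (auto simp: st_cuts_def)
  have fin: "finite (st_cuts (A \<union> B) s t)"
    using finA finB by (auto simp: st_cuts_def intro: finite_subset[of _ "Pow (A \<union> B)"])
  have "Min (arc_cut M w' ` st_cuts (A \<union> B) s t) = (\<Sum>p\<in>A \<times> B. w' p)"
  proof (rule Min_eqI)
    show "(\<Sum>p\<in>A \<times> B. w' p) \<in> arc_cut M w' ` st_cuts (A \<union> B) s t"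
      using AC arc_cut_side[of M w'] by (metis image_eqI)
    show "\<And>y. y \<in> arc_cut M w' ` st_cuts (A \<union> B) s t \<Longrightarrow> (\<Sum>p\<in>A \<times> B. w' p) \<le> y"
      using low by (auto simp: st_cuts_def)
  qed (use fin in auto)
  moreover have "(\<Sum>p\<in>A \<times> B. w' p) = (\<Sum>p\<in>A \<times> B. w p) - w p0"
    using finA finB p0 by (simp add: w'_def sum.remove[of "A \<times> B" p0])
  ultimately show ?thesis
    unfolding mincut_capacity_def w'_def using cut_capacity_failure[OF p0] by simp
qed

text \<open>
  Equal codes give \<open>w p - w' p = S - S'\<close> for all \<open>p\<close>, where \<open>S\<close> and \<open>S'\<close> are the total weights.
  Summing over \<open>p\<close> yields \<open>S - S' = card (A \<times> B) * (S - S')\<close>, hence \<open>S = S'\<close>.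
\<close>

lemma weights_determined:
  assumes answers: "mincut_failure_oracle leaves \<G> (A \<union> B) s t encode query"
    and G: "network M w \<in> \<G>" "network M w' \<in> \<G>"
    and w: "\<And>p. p \<in> A \<times> B \<Longrightarrow> 0 \<le> w p \<and> w p \<le> K"
    and w': "\<And>p. p \<in> A \<times> B \<Longrightarrow> 0 \<le> w' p \<and> w' p \<le> K"
    and M: "real (card A) * K \<le> M" "real (card B) * K \<le> M"
    and two: "2 \<le> card (A \<times> B)"
    and eq: "encode (network M w) = encode (network M w')"
    and p: "p \<in> A \<times> B"
  shows "w p = w' p"
proof -
  let ?S = "\<Sum>p\<in>A \<times> B. w p" let ?S' = "\<Sum>p\<in>A \<times> B. w' p"
  have diff: "w q - w' q = ?S - ?S'" if q: "q \<in> A \<times> B" for q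
  proof -
    have query: "query (encode (network M v)) (case_prod mk q) = (\<Sum>p\<in>A \<times> B. v p) - v q"
      if "network M v \<in> \<G>" "\<And>p. p \<in> A \<times> B \<Longrightarrow> 0 \<le> v p \<and> v p \<le> K" for v
    proof -
      have "case_prod mk q \<in> dom (network M v)"
        using q by (auto simp: dom_network arcs_def)
      with answers that(1) show ?thesis
        unfolding mincut_failure_oracle_def
        using mincut_capacity_failure[OF that(2) M q] by simp
    qed
    show ?thesis
      using query[OF G(1) w] query[OF G(2) w'] eq by simp
  qed
  have "?S - ?S' = (\<Sum>q\<in>A \<times> B. w q - w' q)" by (simp add: sum_subtractf)
  also have "\<dots> = (\<Sum>q\<in>A \<times> B. ?S - ?S')" by (rule sum.cong[OF refl diff])
  also have "\<dots> = real (card (A \<times> B)) * (?S - ?S')" by simp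
  finally have "(real (card (A \<times> B)) - 1) * (?S - ?S') = 0" by (simp add: algebra_simps)
  then have "?S - ?S' = 0" using two by simp
  then show ?thesis using diff[OF p] by simp
qed

end

section \<open>The space bound in either edge model\<close>

lemma (in edge_model) space_lower_bound:
  fixes s t :: 'v and V :: "'v set"
  defines "n \<equiv> card V"
  assumes n: "n \<ge> 4" and W: "admissible_capacities n W" and st: "s \<in> V" "t \<in> V" "s \<noteq> t"
    and answers: "mincut_failure_oracle leaves (graphs V W) V s t encode query"
  shows "\<exists>G \<in> graphs V W. 1/8 * (real n)\<^sup>2 * log 2 (real n) \<le> real (length (encode G))"
proof -
  have finV: "finite V" using n by (metis n_def card.infinite not_numeral_le_zero)
  \<comment> \<open>One place in \<open>A\<close> is reserved for \<open>s\<close>, and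
    \<open>t\<close> must remain outside.\<close>
  have "n div 2 - 1 \<le> card (V - {s, t})"
    using st n finV by (simp add: card_Diff_subset n_def)
  then obtain A0 where A0: "A0 \<subseteq> V - {s, t}" "card A0 = n div 2 - 1" "finite A0"
    by (meson obtain_subset_with_card_n)
  define A where "A = insert s A0"
  define B where "B = V - A"
  have AB: "A \<union> B = V" "A \<inter> B = {}" "s \<in> A" "t \<in> B"
    using st A0 by (auto simp: A_def B_def)
  have fin: "finite A" "finite B" using finV A0 by (auto simp: A_def B_def)
  have cA: "card A = n div 2"
    using A0 n by (auto simp: A_def card_insert_if)
  have cB: "card B = n - n div 2"
    using card_Diff_subset[of A V] AB(1) fin(1) cA by (auto simp: B_def n_def)
  interpret split_network mk leaves A B s t
    using AB fin by unfold_locales auto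
  define m where "m = card (A \<times> B)"
  have m: "m = (n div 2) * (n - n div 2)" by (simp add: m_def card_cartesian_product cA cB)
  \<comment> \<open>For even \<open>n\<close>, \<open>4 * m = n\<^sup>2\<close>; for
    \<open>n = 2 * k + 1\<close>, \<open>m = k * (k + 1)\<close>, and the extra 1 makes the bound
    exact.\<close>
  obtain k where "n = 2 * k \<or> n = 2 * k + 1" by (metis oddE evenE)
  then have m4: "4 * m + 1 \<ge> n\<^sup>2"
    unfolding m by (auto simp: power2_eq_square algebra_simps)
  have m2: "2 \<le> m"
    using m4 power_mono[OF n, of 2] by simp
  \<comment> \<open>Extensional functions: weightings that agree on \<open>A \<times> B\<close> are
    equal, so there are exactly \<open>n ^ m\<close> of them.\<close>
  define Ws where "Ws = (A \<times> B \<rightarrow>\<^sub>E {1..n})"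
  define enc where "enc w = encode (network (real (n\<^sup>2)) (\<lambda>p. real (w p)))" for w
  have card_Ws: "card Ws = n ^ m"
    using fin by (simp add: Ws_def card_PiE m_def)
  have fin_Ws: "finite Ws"
    using fin by (simp add: Ws_def finite_PiE)
  have ran: "w p \<in> {1..n}" if "w \<in> Ws" "p \<in> A \<times> B" for w p
    using that by (auto simp: Ws_def PiE_iff)
  have "n \<le> n\<^sup>2" by (simp add: power2_eq_square)
  then have in_graphs: "network (real (n\<^sup>2)) (\<lambda>p. real (w p)) \<in> graphs V W" if "w \<in> Ws" for w
    using W ran[OF that] n AB(1) unfolding admissible_capacities_def
    by (intro network_in_graphs) fastforce+
  \<comment> \<open>A row or column has at most \<open>n\<close> entries, each at most
    \<open>n\<close>; hence heavy edges of capacity \<open>n\<^sup>2\<close>, the largest integer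
    guaranteed admissible.\<close>
  have bounds: "real (card A) * real n \<le> real (n\<^sup>2)" "real (card B) * real n \<le> real (n\<^sup>2)"
    unfolding of_nat_mult[symmetric] of_nat_le_iff power2_eq_square cA cB
    by (intro mult_right_mono; simp)+
  have answers': "mincut_failure_oracle leaves (graphs V W) (A \<union> B) s t encode query"
    using answers AB(1) by simp
  have "inj_on enc Ws"
  proof (rule inj_onI)
    fix w w' assume w: "w \<in> Ws" "w' \<in> Ws" "enc w = enc w'"
    have "real (w p) = real (w' p)" if "p \<in> A \<times> B" for p
      using weights_determined[OF answers' in_graphs[OF w(1)] in_graphs[OF w(2)],
        of "real n" p] ran[OF w(1)] ran[OF w(2)] bounds m2 w(3) that
      by (simp add: m_def enc_def)
    then show "w = w'"
      using w by (auto simp: Ws_def intro: PiE_ext)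
  qed
  moreover have "Ws \<noteq> {}" using card_Ws n by auto
  ultimately obtain w where "w \<in> Ws" "card Ws < 2 ^ Suc (length (enc w))"
    using long_code_exists[OF fin_Ws] by blast
  then show ?thesis
    using in_graphs log_bound[OF n m4] unfolding card_Ws enc_def by blast
qed

section \<open>Directed and undirected graphs as instances\<close>

interpretation directed: edge_model Pair directed_leaves
  by unfold_locales (auto simp: directed_leaves_def)

lemma directed_graphs_eq: "directed.graphs V W = directed_graphs V W"
  by (auto simp: directed.graphs_def directed_graphs_def)

interpretation undirected: edge_model "\<lambda>u v. {u, v}" undirected_leaves
  by unfold_locales (auto simp: undirected_leaves_def doubleton_eq_iff)

lemma undirected_graphs_eq: "undirected.graphs V W = undirected_graphs V W"
proof -
  have "{{u, v} | u v. u \<in> V \<and> v \<in> V \<and> u \<noteq> v} = {e. e \<subseteq> V \<and> card e = 2}"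
    by (auto simp: card_2_iff)
  then show ?thesis
    by (simp add: undirected.graphs_def undirected_graphs_def)
qed

theorem theorem10:
  shows
    "(\<exists>c>0. \<exists>N. \<forall>n\<ge>N. \<forall>(W :: real set) (s :: nat) t encode query.
        admissible_capacities n W \<and> s < n \<and> t < n \<and> s \<noteq> t \<and>
        mincut_failure_oracle undirected_leaves (undirected_graphs {..<n} W) {..<n} s t encode query
        \<longrightarrow> (\<exists>G \<in> undirected_graphs {..<n} W.
              real (length (encode G)) \<ge> c * (real n)^2 * log 2 (real n)))
     \<and>
     (\<exists>c>0. \<exists>N. \<forall>n\<ge>N. \<forall>(W :: real set) (s :: nat) t encode query.
        admissible_capacities n W \<and> s < n \<and> t < n \<and> s \<noteq> t \<and>
        mincut_failure_oracle directed_leaves (directed_graphs {..<n} W) {..<n} s t encode query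
        \<longrightarrow> (\<exists>G \<in> directed_graphs {..<n} W.
              real (length (encode G)) \<ge> c * (real n)^2 * log 2 (real n)))"
proof (rule conjI)
  show "\<exists>c>0. \<exists>N. \<forall>n\<ge>N. \<forall>(W :: real set) (s :: nat) t encode query.
        admissible_capacities n W \<and> s < n \<and> t < n \<and> s \<noteq> t \<and>
        mincut_failure_oracle undirected_leaves (undirected_graphs {..<n} W) {..<n} s t encode query
        \<longrightarrow> (\<exists>G \<in> undirected_graphs {..<n} W.
              real (length (encode G)) \<ge> c * (real n)^2 * log 2 (real n))"
    \<comment> \<open>The constant 1/8 and the threshold 4 are those of
      \<open>log_bound\<close>.\<close>
    using undirected.space_lower_bound[of "{..<_::nat}", unfolded undirected_graphs_eq card_lessThan]
    by (intro exI[of _ "1/8"] conjI exI[of _ 4]) auto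
  show "\<exists>c>0. \<exists>N. \<forall>n\<ge>N. \<forall>(W :: real set) (s :: nat) t encode query.
        admissible_capacities n W \<and> s < n \<and> t < n \<and> s \<noteq> t \<and>
        mincut_failure_oracle directed_leaves (directed_graphs {..<n} W) {..<n} s t encode query
        \<longrightarrow> (\<exists>G \<in> directed_graphs {..<n} W.
              real (length (encode G)) \<ge> c * (real n)^2 * log 2 (real n))"
    using directed.space_lower_bound[of "{..<_::nat}", unfolded directed_graphs_eq card_lessThan]
    by (intro exI[of _ "1/8"] conjI exI[of _ 4]) auto
qed

end
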